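(* Suppose there are no inequality constraints ($K=0$) and $\sum_ir_i=\sum_jc_j=1$. Let $(x,y,a)\in\mathbb{R}^n\times\mathbb{R}^n\times\mathbb{R}^L$ be dual variables with associated matrix $P$. Let $(a',t')\in\operatorname{argmax}_{\tilde a\in\mathbb{R}^L,\,\tilde t\in\mathbb{R}}f(x+\tilde t\mathbf{1},y,\tilde a)$, and let $P'$ be the matrix associated with $(x+t'\mathbf{1},y,a')$. Then the $a$ update step is a Bregman projection: $$P'=\operatorname{argmin}_{M\in\Delta_{n\times n}\cap\mathcal{E}}\mathrm{KL}(M\,\|\,P).$$
   Context: Data: $\eta>0$; $C,D_1,\dots,D_L\in\mathbb{R}^{n\times n}$; $r,c\in\mathbb{R}^n$ densities. $M\cdot M'=\sum_{ij}m_{ij}m'_{ij}$; $\exp$ of a matrix is entrywise; $\mathbf{1}$ is the all-ones vector. The matrix associated with $(x,y,a)$ is $P=\exp\big(\eta(-C+\sum_{l=1}^La_lD_l+x\mathbf{1}^{\top}+\mathbf{1}y^{\top})-1\big)$, and $$f(x,y,a)=-\frac1\eta\sum_{ij}\exp\Big(\eta\big(-C_{ij}+\sum_{l=1}^La_l(D_l)_{ij}+x_i+y_j\big)-1\Big)+\sum_ix_ir_i+\sum_jy_jc_j .$$ $\mathcal{E}=\bigcap_{l=1}^L\{M\in\mathbb{R}^{n\times n}:D_l\cdot M=0\}$; $\Delta_{n\times n}=\{M\in\mathbb{R}^{n\times n}:M\ge0,\ \sum_{ij}M_{ij}=1\}$ is the simplex. For entrywise nonnegative matrices, $\mathrm{KL}(M\,\|\,N)=\sum_{ij}m_{ij}\big(\log(m_{ij}/n_{ij})-1\big)$,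 with $0\log0=0$. *)

theory Defs
  imports "HOL-Analysis.Analysis"
begin

text \<open>
  The space \<open>\<real>\<^sup>L\<close> is rendered as the set of extensional functions on \<open>{1..L}\<close>, so that
  \<open>L = 0\<close> is covered.
\<close>

definition coeff_space :: "nat \<Rightarrow> (nat \<Rightarrow> real) set" where
  "coeff_space L = {1..L} \<rightarrow>\<^sub>E UNIV"

definition dual_matrix ::
  "real \<Rightarrow> real^'n^'n \<Rightarrow> nat \<Rightarrow> (nat \<Rightarrow> real^'n^'n) \<Rightarrow> real^'n \<Rightarrow> real^'n \<Rightarrow> (nat \<Rightarrow> real)
    \<Rightarrow> real^('n::finite)^'n" where
  "dual_matrix \<eta> C L D x y a =
    (\<chi> i j. exp (\<eta> * (- C $ i $ j + (\<Sum>l=1..L. a l * D l $ i $ j) + x $ i + y $ j) - 1))"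

definition dual_objective ::
  "real \<Rightarrow> real^'n^'n \<Rightarrow> nat \<Rightarrow> (nat \<Rightarrow> real^'n^'n) \<Rightarrow> real^'n \<Rightarrow> real^'n
    \<Rightarrow> real^'n \<Rightarrow> real^'n \<Rightarrow> (nat \<Rightarrow> real) \<Rightarrow> real" where
  "dual_objective \<eta> C L D r c x y a =
    - (1 / \<eta>) * (\<Sum>i\<in>UNIV. \<Sum>j\<in>UNIV.
        exp (\<eta> * (- C $ i $ j + (\<Sum>l=1..L. a l * D l $ i $ j) + x $ i + y $ j) - 1))
    + (\<Sum>i\<in>UNIV. x $ i * r $ i) + (\<Sum>j\<in>UNIV. y $ j * c $ j)"

text \<open>The inner product on \<open>real^'n^'n\<close> is the entrywise one, i.e. the sum of the products of entries.\<close>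

definition constraint_space :: "nat \<Rightarrow> (nat \<Rightarrow> real^'n^'n) \<Rightarrow> (real^('n::finite)^'n) set" where
  "constraint_space L D = (\<Inter>l\<in>{1..L}. {M. D l \<bullet> M = 0})"

definition matrix_simplex :: "(real^('n::finite)^'n) set" where
  "matrix_simplex = {M. (\<forall>i j. 0 \<le> M $ i $ j) \<and> (\<Sum>i\<in>UNIV. \<Sum>j\<in>UNIV. M $ i $ j) = 1}"

text \<open>
  The convention \<open>0 log 0 = 0\<close> holds because of the factor \<open>M $ i $ j\<close>. The definition is meant for
  nonnegative \<open>M\<close> and positive \<open>N\<close>: where an entry of \<open>N\<close> is zero and that of \<open>M\<close> is not, it does
  not give the value infinity.
\<close>

definition KL :: "real^'n^'n \<Rightarrow> real^('n::finite)^'n \<Rightarrow> real" where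
  "KL M N = (\<Sum>i\<in>UNIV. \<Sum>j\<in>UNIV. M $ i $ j * (ln (M $ i $ j / N $ i $ j) - 1))"

end

theory Submission
  imports Defs
begin

text \<open>
  Optimality of \<open>(a', t')\<close> makes \<open>P'\<close> feasible: the partial derivatives of the dual objective with
  respect to \<open>a\<^sub>l\<close> and \<open>t\<close> are \<open>- D\<^sub>l \<bullet> P'\<close> and \<open>1\<close> minus the total mass of \<open>P'\<close>, and
  both vanish (\<open>dual_matrix_orthogonal_at_max\<close>, \<open>dual_matrix_mass_at_max\<close>).

  Moreover \<open>P'\<close> lies in the exponential family through \<open>P\<close> spanned by the constraints:
  \<open>ln P' - ln P\<close> is \<open>\<eta>\<close> times a combination of the \<open>D\<^sub>l\<close> and the all-ones matrix. Pairing it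
  with a feasible \<open>M\<close> annihilates the \<open>D\<^sub>l\<close> and turns the all-ones matrix into \<open>1\<close>, so that
  \<open>KL M P\<close> and \<open>KL M P'\<close> differ by a constant independent of \<open>M\<close> (\<open>KL_dual_matrix_shift\<close>).
  The minimizers of \<open>KL M P\<close> over the feasible set are thus those of \<open>KL M P'\<close>, and by the Gibbs
  inequality (\<open>KL_ge_mass\<close>, \<open>KL_eq_mass_imp_eq\<close>) the only one is \<open>P'\<close> itself.
\<close>

section \<open>The Gibbs inequality\<close>

text \<open>This is \<open>ln z \<le> z - 1\<close>, with equality only for \<open>z = 1\<close>, at \<open>z = p / m\<close>.\<close>

lemma mult_ln_div_ge:
  fixes m p :: real
  assumes "m \<ge> 0" "p > 0"
  shows "m * (ln (m / p) - 1) \<ge> - p"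
    and "m * (ln (m / p) - 1) = - p \<Longrightarrow> m = p"
proof -
  have eq: "m * (ln (m / p) - 1) + p = m * (p / m - 1 - ln (p / m))" if "m > 0"
    using that assms by (simp add: ln_div algebra_simps)
  show "m * (ln (m / p) - 1) \<ge> - p"
  proof (cases "m = 0")
    case False
    then have "m > 0" using assms by simp
    then have "0 \<le> m * (p / m - 1 - ln (p / m))"
      using ln_le_minus_one[of "p / m"] assms by simp
    then show ?thesis using eq[OF \<open>m > 0\<close>] by linarith
  qed (use assms in simp)
  show "m = p" if h: "m * (ln (m / p) - 1) = - p"
  proof -
    have "m > 0" using h assms by (cases "m = 0") auto
    then have "ln (p / m) = p / m - 1" using eq h by simp
    then have "p / m = 1" using ln_eq_minus_one[of "p / m"] \<open>m > 0\<close> assms by simp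
    then show ?thesis using \<open>m > 0\<close> by simp
  qed
qed

lemma KL_ge_mass:
  assumes "\<And>i j. M $ i $ j \<ge> 0" "\<And>i j. N $ i $ j > 0"
  shows "KL M N \<ge> - (\<Sum>i\<in>UNIV. \<Sum>j\<in>UNIV. N $ i $ j)"
  unfolding KL_def sum_negf[symmetric]
  by (intro sum_mono mult_ln_div_ge(1) assms)

lemma KL_eq_mass_imp_eq:
  assumes M: "\<And>i j. M $ i $ j \<ge> 0" and N: "\<And>i j. N $ i $ j > 0"
    and eq: "KL M N = - (\<Sum>i\<in>UNIV. \<Sum>j\<in>UNIV. N $ i $ j)"
  shows "M = N"
proof -
  define g where "g i j = M $ i $ j * (ln (M $ i $ j / N $ i $ j) - 1) + N $ i $ j" for i j
  have g: "g i j \<ge> 0" for i j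
    using mult_ln_div_ge(1)[OF M N, of i j i j] by (simp add: g_def)
  have "(\<Sum>i\<in>UNIV. \<Sum>j\<in>UNIV. g i j) = 0"
    using eq by (simp add: g_def KL_def sum.distrib)
  then have "g i j = 0" for i j
    using g by (simp add: sum_nonneg_eq_0_iff sum_nonneg)
  then have "M $ i $ j = N $ i $ j" for i j
    by (intro mult_ln_div_ge(2)[OF M N]) (simp add: g_def eq_neg_iff_add_eq_0)
  then show ?thesis by (simp add: vec_eq_iff)
qed

lemma KL_self:
  assumes "\<And>i j. N $ i $ j > 0"
  shows "KL N N = - (\<Sum>i\<in>UNIV. \<Sum>j\<in>UNIV. N $ i $ j)"
  using assms by (simp add: KL_def sum_negf less_imp_neq[symmetric])

section \<open>First-order optimality of the dual variables\<close>

lemma inner_matrix: "A \<bullet> B = (\<Sum>i\<in>UNIV. \<Sum>j\<in>UNIV. A $ i $ j * B $ i $ j)"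
  for A B :: "real^'n^'m"
  by (simp add: inner_vec_def)

text \<open>
  Along any line in the dual variables the objective is an exponential sum plus an affine function;
  this is the vanishing of its derivative at a maximum. It serves both the \<open>a\<^sub>l\<close> directions
  (\<open>w = 0\<close>) and the shift \<open>t\<close> (\<open>W\<close> all ones, \<open>w = 1\<close>).
\<close>

lemma exp_line_max_imp_inner_eq:
  fixes Q W :: "real^'n^'m" and \<eta> k w :: real
  assumes "\<eta> > 0"
    and g: "\<And>e. g e = - (1 / \<eta>) * (\<Sum>i\<in>UNIV. \<Sum>j\<in>UNIV. Q $ i $ j * exp (\<eta> * e * W $ i $ j)) + k + e * w"
    and max: "\<And>e. g e \<le> g 0"
  shows "W \<bullet> Q = w"
proof -
  have "(g has_real_derivative
      - (1 / \<eta>) * (\<Sum>i\<in>UNIV. \<Sum>j\<in>UNIV. Q $ i $ j * (\<eta> * W $ i $ j)) + w) (at 0)"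
    unfolding g[abs_def] using \<open>\<eta> > 0\<close> by (auto intro!: derivative_eq_intros sum.cong)
  then have "- (1 / \<eta>) * (\<Sum>i\<in>UNIV. \<Sum>j\<in>UNIV. Q $ i $ j * (\<eta> * W $ i $ j)) + w = 0"
    by (rule DERIV_local_max[of _ _ _ 1]) (use max in auto)
  moreover have "(\<Sum>i\<in>UNIV. \<Sum>j\<in>UNIV. Q $ i $ j * (\<eta> * W $ i $ j)) = \<eta> * (W \<bullet> Q)"
    by (simp add: inner_matrix sum_distrib_left mult_ac)
  ultimately show ?thesis using \<open>\<eta> > 0\<close> by simp
qed

lemma dual_matrix_pos: "dual_matrix \<eta> C L D x y a $ i $ j > 0"
  by (simp add: dual_matrix_def)

lemma dual_objective_eq:
  "dual_objective \<eta> C L D r c x y a =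
    - (1 / \<eta>) * (\<Sum>i\<in>UNIV. \<Sum>j\<in>UNIV. dual_matrix \<eta> C L D x y a $ i $ j)
    + (\<Sum>i\<in>UNIV. x $ i * r $ i) + (\<Sum>j\<in>UNIV. y $ j * c $ j)"
  by (simp add: dual_objective_def dual_matrix_def)

lemma dual_matrix_update:
  assumes "l \<in> {1..L}"
  shows "dual_matrix \<eta> C L D x y (a(l := a l + e)) $ i $ j =
    dual_matrix \<eta> C L D x y a $ i $ j * exp (\<eta> * e * D l $ i $ j)"
proof -
  have "(\<Sum>k=1..L. (a(l := a l + e)) k * D k $ i $ j) =
      (\<Sum>k=1..L. a k * D k $ i $ j + (if k = l then e * D l $ i $ j else 0))"
    by (intro sum.cong) (auto simp: algebra_simps)
  also have "\<dots> = (\<Sum>k=1..L. a k * D k $ i $ j) + e * D l $ i $ j"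
    using assms by (simp add: sum.distrib)
  finally show ?thesis
    by (simp add: dual_matrix_def algebra_simps flip: exp_add del: fun_upd_apply)
qed

lemma dual_matrix_shift:
  "dual_matrix \<eta> C L D (x + e *\<^sub>R 1) y a $ i $ j = dual_matrix \<eta> C L D x y a $ i $ j * exp (\<eta> * e)"
  by (simp add: dual_matrix_def algebra_simps flip: exp_add)

lemma dual_matrix_orthogonal_at_max:
  assumes "\<eta> > 0" and l: "l \<in> {1..L}"
    and max: "\<And>e. dual_objective \<eta> C L D r c x y (a(l := a l + e)) \<le> dual_objective \<eta> C L D r c x y a"
  shows "D l \<bullet> dual_matrix \<eta> C L D x y a = 0"
proof (rule exp_line_max_imp_inner_eq[OF \<open>\<eta> > 0\<close>])
  let ?g = "\<lambda>e. dual_objective \<eta> C L D r c x y (a(l := a l + e))"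
  show "?g e = - (1 / \<eta>) * (\<Sum>i\<in>UNIV. \<Sum>j\<in>UNIV.
        dual_matrix \<eta> C L D x y a $ i $ j * exp (\<eta> * e * D l $ i $ j))
      + ((\<Sum>i\<in>UNIV. x $ i * r $ i) + (\<Sum>j\<in>UNIV. y $ j * c $ j)) + e * 0" for e
    by (simp add: dual_objective_eq dual_matrix_update[OF l] del: fun_upd_apply)
  show "?g e \<le> ?g 0" for e
    using max[of e] by simp
qed

lemma dual_matrix_mass_at_max:
  fixes x :: "real^('n::finite)"
  assumes "\<eta> > 0" and r: "(\<Sum>i\<in>UNIV. r $ i) = 1"
    and max: "\<And>e. dual_objective \<eta> C L D r c (x + e *\<^sub>R 1) y a \<le> dual_objective \<eta> C L D r c x y a"
  shows "(\<Sum>i\<in>UNIV. \<Sum>j\<in>UNIV. dual_matrix \<eta> C L D x y a $ i $ j) = 1"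
proof -
  let ?g = "\<lambda>e. dual_objective \<eta> C L D r c (x + e *\<^sub>R 1) y a"
  have "(1 :: real^'n^'n) \<bullet> dual_matrix \<eta> C L D x y a = 1"
  proof (rule exp_line_max_imp_inner_eq[OF \<open>\<eta> > 0\<close>])
    fix e
    have "(\<Sum>i\<in>UNIV. (x + e *\<^sub>R 1) $ i * r $ i) = (\<Sum>i\<in>UNIV. x $ i * r $ i) + e"
      using r by (simp add: distrib_right sum.distrib flip: sum_distrib_left)
    then show "?g e = - (1 / \<eta>) * (\<Sum>i\<in>UNIV. \<Sum>j\<in>UNIV.
          dual_matrix \<eta> C L D x y a $ i $ j * exp (\<eta> * e * (1 :: real^'n^'n) $ i $ j))
        + ((\<Sum>i\<in>UNIV. x $ i * r $ i) + (\<Sum>j\<in>UNIV. y $ j * c $ j)) + e * 1"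
      by (simp only: dual_objective_eq dual_matrix_shift) simp
    show "?g e \<le> ?g 0"
      using max[of e] by simp
  qed
  then show ?thesis by (simp add: inner_matrix)
qed

section \<open>The projection\<close>

text \<open>
  The affine identity behind the Bregman projection: \<open>M\<close> sees only the mass component of
  \<open>ln P' - ln P\<close>.
\<close>

lemma KL_dual_matrix_shift:
  fixes M :: "real^('n::finite)^'n"
  assumes M: "M \<in> matrix_simplex \<inter> constraint_space L D"
  shows "KL M (dual_matrix \<eta> C L D x y a) =
    KL M (dual_matrix \<eta> C L D (x + t *\<^sub>R 1) y a') + \<eta> * t"
proof -
  let ?P = "dual_matrix \<eta> C L D x y a" and ?Q = "dual_matrix \<eta> C L D (x + t *\<^sub>R 1) y a'"
  let ?H = "(\<Sum>l=1..L. (a' l - a l) *\<^sub>R D l)"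
  have mass: "(\<Sum>i\<in>UNIV. \<Sum>j\<in>UNIV. M $ i $ j) = 1"
    using M by (simp add: matrix_simplex_def)
  have nonneg: "M $ i $ j \<ge> 0" for i j
    using M by (simp add: matrix_simplex_def)
  have "?H \<bullet> M = 0"
    using M by (auto simp: inner_sum_left constraint_space_def intro!: sum.neutral)
  have ln: "ln (?Q $ i $ j) - ln (?P $ i $ j) = \<eta> * (?H $ i $ j + t)" for i j
    by (simp add: dual_matrix_def algebra_simps sum_subtractf)
  have entry: "M $ i $ j * (ln (M $ i $ j / ?P $ i $ j) - 1) =
      M $ i $ j * (ln (M $ i $ j / ?Q $ i $ j) - 1) + \<eta> * (?H $ i $ j * M $ i $ j) + \<eta> * t * M $ i $ j"
    for i j
  proof (cases "M $ i $ j = 0")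
    case False
    then have "M $ i $ j > 0" using nonneg[of i j] by simp
    then have "ln (M $ i $ j / ?P $ i $ j) = ln (M $ i $ j / ?Q $ i $ j) + \<eta> * (?H $ i $ j + t)"
      unfolding ln[symmetric] by (simp add: ln_div dual_matrix_pos less_imp_neq[OF dual_matrix_pos, symmetric])
    then show ?thesis by (simp only: algebra_simps)
  qed simp
  have "KL M ?P = KL M ?Q + \<eta> * (?H \<bullet> M) + \<eta> * t * (\<Sum>i\<in>UNIV. \<Sum>j\<in>UNIV. M $ i $ j)"
    unfolding KL_def entry inner_matrix by (simp only: sum.distrib sum_distrib_left)
  then show ?thesis using \<open>?H \<bullet> M = 0\<close> mass by simp
qed

theorem mainTheorem6:
  fixes \<eta> :: real
    and C :: "real^('n::finite)^'n"
    and L :: nat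
    and D :: "nat \<Rightarrow> real^'n^'n"
    and r c x y :: "real^'n"
    and a a' :: "nat \<Rightarrow> real"
    and t' :: real
    and P P' :: "real^'n^'n"
  assumes "\<eta> > 0"
    and "\<And>i. r $ i \<ge> 0" and "(\<Sum>i\<in>UNIV. r $ i) = 1"
    and "\<And>j. c $ j \<ge> 0" and "(\<Sum>j\<in>UNIV. c $ j) = 1"
    and "a \<in> coeff_space L"
    and "P = dual_matrix \<eta> C L D x y a"
    and "is_arg_max (\<lambda>(b, s). dual_objective \<eta> C L D r c (x + s *\<^sub>R 1) y b)
           (\<lambda>(b, s). b \<in> coeff_space L) (a', t')"
    and "P' = dual_matrix \<eta> C L D (x + t' *\<^sub>R 1) y a'"
  shows "{M. is_arg_min (\<lambda>M. KL M P) (\<lambda>M. M \<in> matrix_simplex \<inter> constraint_space L D) M} = {P'}"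
proof -
  let ?F = "matrix_simplex \<inter> constraint_space L D"
  have a': "a' \<in> coeff_space L"
    and max: "\<And>b s. b \<in> coeff_space L \<Longrightarrow> dual_objective \<eta> C L D r c (x + s *\<^sub>R 1) y b
        \<le> dual_objective \<eta> C L D r c (x + t' *\<^sub>R 1) y a'"
    using assms(8) by (auto simp: is_arg_max_linorder)
  have pos: "P' $ i $ j > 0" for i j
    by (simp add: assms(9) dual_matrix_pos)
  have mass: "(\<Sum>i\<in>UNIV. \<Sum>j\<in>UNIV. P' $ i $ j) = 1"
    unfolding assms(9)
  proof (rule dual_matrix_mass_at_max[OF assms(1,3)])
    show "dual_objective \<eta> C L D r c (x + t' *\<^sub>R 1 + e *\<^sub>R 1) y a'
        \<le> dual_objective \<eta> C L D r c (x + t' *\<^sub>R 1) y a'" for e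
      using max[OF a', of "t' + e"] by (simp add: scaleR_left_distrib add.assoc)
  qed
  have "D l \<bullet> P' = 0" if l: "l \<in> {1..L}" for l
    unfolding assms(9)
  proof (rule dual_matrix_orthogonal_at_max[OF assms(1) l])
    have "a'(l := a' l + e) \<in> coeff_space L" for e
      using a' l by (auto simp: coeff_space_def PiE_def extensional_def)
    then show "dual_objective \<eta> C L D r c (x + t' *\<^sub>R 1) y (a'(l := a' l + e))
        \<le> dual_objective \<eta> C L D r c (x + t' *\<^sub>R 1) y a'" for e
      by (rule max)
  qed
  then have P'_feasible: "P' \<in> ?F"
    using mass pos by (auto simp: matrix_simplex_def constraint_space_def less_imp_le)
  have shift: "KL M P = KL M P' + \<eta> * t'" if "M \<in> ?F" for M
    unfolding assms(7,9) by (rule KL_dual_matrix_shift[OF that])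
  have nonneg: "M $ i $ j \<ge> 0" if "M \<in> ?F" for M i j
    using that by (simp add: matrix_simplex_def)
  have min: "KL P' P \<le> KL M P" if "M \<in> ?F" for M
    using KL_ge_mass[OF nonneg[OF that] pos] KL_self[of P', OF pos] shift[OF that] shift[OF P'_feasible]
    by simp
  have unique: "M = P'" if M: "M \<in> ?F" and le: "KL M P \<le> KL P' P" for M
  proof (rule KL_eq_mass_imp_eq[OF nonneg[OF M] pos])
    have "KL M P' \<le> KL P' P'"
      using le shift[OF M] shift[OF P'_feasible] by simp
    then show "KL M P' = - (\<Sum>i\<in>UNIV. \<Sum>j\<in>UNIV. P' $ i $ j)"
      using KL_ge_mass[OF nonneg[OF M] pos] KL_self[of P', OF pos] by simp
  qed
  show ?thesis
    using P'_feasible min unique by (auto simp only: is_arg_min_linorder)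
qed

end
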